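(* Let $k\ge 3$ be an odd integer, let $G=(V,E)$ be a graph and let $\mathbf w:E\to\mathbb Z_{+}$ be an edge weight function. Let $E_k$ be the edge set produced by the following algorithm: (1) Let $\hat{\mathbf x}^*$ be an optimal solution of the linear program $\min\{\mathbf w^T\mathbf x : A\mathbf x\ge \mathbf 1,\ 0\le \mathbf x\le 1\}$, where $A$ is the $k$-cycle--edge incidence matrix of $G$ (rows indexed by the $k$-cycles of $G$, columns by the edges, entry $1$ iff the edge lies on the cycle). (2) Let $E_{k_1}=\{e\in E : \hat{\mathbf x}^*_e\ge 2/(2k-1)\}$. (3) Let $E'$ be the set of edges lying on some $k$-cycle of $G-E_{k_1}$, and let $G'$ be the subgraph of $G$ formed by the edge set $E'$. (4) Choose any bipartite subgraph $B=(V_1,V_2,E_B)$ of $G'$ with $\mathbf w(E_B)\ge \tfrac12\mathbf w(E')$, and let $E_{k_2}=E'\setminus E_B$. (5) Output $E_k=E_{k_1}\cup E_{k_2}$. Then $E_k$ is a $k$-cycle covering of $G$ and $\mathbf w(E_k)\le (k-\tfrac12)\,\tau_k(G_w)$.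
   Context: A $k$-cycle covering of $G$ is an edge subset $A\subseteq E$ such that $G-A$ contains no cycle of length $k$. The weighted covering number $\tau_k(G_w)$ is the minimum of $\sum_{e\in A}\mathbf w_e$ over all $k$-cycle coverings $A$ of $G$, equivalently $\min\{\mathbf w^T\mathbf x: A\mathbf x\ge\mathbf 1,\ \mathbf x\in\{0,1\}^{E}\}$ with $A$ the $k$-cycle--edge incidence matrix. For $F\subseteq E$, $\mathbf w(F)=\sum_{e\in F}\mathbf w_e$. *)

theory Defs
  imports Complex_Main
begin

text \<open>
  A graph is a pair of a vertex set and a set of edges; graphs are finite and simple,
  so an edge is a two-element set of vertices.
\<close>

type_synonym 'a graph = "'a set \<times> 'a set set"

abbreviation verts :: "'a graph \<Rightarrow> 'a set" where
  "verts G \<equiv> fst G"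

abbreviation edges :: "'a graph \<Rightarrow> 'a set set" where
  "edges G \<equiv> snd G"

definition graph :: "'a graph \<Rightarrow> bool" where
  "graph G \<longleftrightarrow> finite (verts G) \<and> (\<forall>e\<in>edges G. e \<subseteq> verts G \<and> card e = 2)"

definition subgraph :: "'a graph \<Rightarrow> 'a graph \<Rightarrow> bool" where
  "subgraph H G \<longleftrightarrow> graph H \<and> verts H \<subseteq> verts G \<and> edges H \<subseteq> edges G"

definition delete_edges :: "'a graph \<Rightarrow> 'a set set \<Rightarrow> 'a graph" where
  "delete_edges G F = (verts G, edges G - F)"

definition formed_by :: "'a set set \<Rightarrow> 'a graph" where
  "formed_by F = (\<Union>F, F)"

definition bipartition :: "'a graph \<Rightarrow> 'a set \<Rightarrow> 'a set \<Rightarrow> bool" where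
  "bipartition B V1 V2 \<longleftrightarrow>
     verts B = V1 \<union> V2 \<and> V1 \<inter> V2 = {} \<and> (\<forall>e\<in>edges B. \<exists>u\<in>V1. \<exists>v\<in>V2. e = {u, v})"

definition closed_walk_edges :: "'a list \<Rightarrow> 'a set set" where
  "closed_walk_edges vs = {{vs ! i, vs ! ((i + 1) mod length vs)} | i. i < length vs}"

text \<open>
  A cycle is represented by its edge set, so that cyclic shifts and reversals of
  the same vertex sequence are one cycle.
\<close>

definition k_cycles :: "nat \<Rightarrow> 'a graph \<Rightarrow> 'a set set set" where
  "k_cycles k G = {closed_walk_edges vs | vs.
     3 \<le> k \<and> length vs = k \<and> distinct vs \<and> set vs \<subseteq> verts G \<and> closed_walk_edges vs \<subseteq> edges G}"

definition k_cycle_covering :: "nat \<Rightarrow> 'a graph \<Rightarrow> 'a set set \<Rightarrow> bool" where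
  "k_cycle_covering k G A \<longleftrightarrow> A \<subseteq> edges G \<and> k_cycles k (delete_edges G A) = {}"

definition weight :: "('a set \<Rightarrow> nat) \<Rightarrow> 'a set set \<Rightarrow> nat" where
  "weight w F = (\<Sum>e\<in>F. w e)"

definition covering_number :: "nat \<Rightarrow> 'a graph \<Rightarrow> ('a set \<Rightarrow> nat) \<Rightarrow> nat" where
  "covering_number k G w = Min {weight w A | A. k_cycle_covering k G A}"

definition incidence :: "'a set set \<Rightarrow> 'a set \<Rightarrow> real" where
  "incidence C e = (if e \<in> C then 1 else 0)"

definition lp_feasible :: "nat \<Rightarrow> 'a graph \<Rightarrow> ('a set \<Rightarrow> real) \<Rightarrow> bool" where
  "lp_feasible k G x \<longleftrightarrow>
     (\<forall>C\<in>k_cycles k G. (\<Sum>e\<in>edges G. incidence C e * x e) \<ge> 1) \<and>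
     (\<forall>e\<in>edges G. 0 \<le> x e \<and> x e \<le> 1)"

definition lp_value :: "'a graph \<Rightarrow> ('a set \<Rightarrow> nat) \<Rightarrow> ('a set \<Rightarrow> real) \<Rightarrow> real" where
  "lp_value G w x = (\<Sum>e\<in>edges G. real (w e) * x e)"

definition lp_optimal :: "nat \<Rightarrow> 'a graph \<Rightarrow> ('a set \<Rightarrow> nat) \<Rightarrow> ('a set \<Rightarrow> real) \<Rightarrow> bool" where
  "lp_optimal k G w x \<longleftrightarrow>
     lp_feasible k G x \<and> (\<forall>y. lp_feasible k G y \<longrightarrow> lp_value G w x \<le> lp_value G w y)"

end

theory Submission
  imports Defs
begin

text \<open>
  Round up the edges with \<open>x e \<ge> t\<close>. A surviving \<open>k\<close>-cycle has total value at least 1 while its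
  other edges have value below \<open>t\<close>, so each of its edges still has value at least \<open>1 - (k - 1) t\<close>.
  Charging weight to the LP value therefore costs a factor \<open>1 / t\<close> on the rounded edges and, since
  a bipartite graph keeps half the weight of the surviving cycles, \<open>1 / (2 (1 - (k - 1) t))\<close> on
  those. The two factors agree at \<open>t = 2 / (2 k - 1)\<close>, with common value \<open>k - 1/2\<close>.
  Nothing survives at the end because a bipartite graph has no cycle of odd length \<open>k\<close>.
\<close>

lemma sum_le_member_plus_bound:
  fixes f :: "'a \<Rightarrow> 'b::linordered_idom"
  assumes "finite A" "a \<in> A" "\<And>b. b \<in> A \<Longrightarrow> f b \<le> t"
  shows "sum f A \<le> f a + of_nat (card A - 1) * t"
proof -
  have "sum f (A - {a}) \<le> of_nat (card (A - {a})) * t"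
    by (rule sum_bounded_above) (use assms(3) in auto)
  then show ?thesis using assms(1,2) by (simp add: sum.remove[of A a])
qed

lemma finite_edges:
  assumes "graph G"
  shows "finite (edges G)"
proof (rule finite_subset)
  show "edges G \<subseteq> Pow (verts G)" using assms by (auto simp: graph_def)
  show "finite (Pow (verts G))" using assms by (simp add: graph_def)
qed

lemma closed_walk_edges_eq_image:
  "closed_walk_edges vs = (\<lambda>i. {vs ! i, vs ! ((i + 1) mod length vs)}) ` {..<length vs}"
  by (auto simp: closed_walk_edges_def)

lemma even_length_bipartite_closed_walk:
  assumes bip: "bipartition B V1 V2" and walk: "closed_walk_edges vs \<subseteq> edges B"
  shows "even (length vs)"
proof (cases "vs = []")
  case False
  let ?n = "length vs"
  have switch: "vs ! ((i + 1) mod ?n) \<in> V1 \<longleftrightarrow> vs ! i \<notin> V1" if "i < ?n" for i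
  proof -
    have "{vs ! i, vs ! ((i + 1) mod ?n)} \<in> edges B"
      using walk that by (auto simp: closed_walk_edges_def)
    then obtain u v where "u \<in> V1" "v \<in> V2" "{vs ! i, vs ! ((i + 1) mod ?n)} = {u, v}"
      using bip by (auto simp: bipartition_def)
    moreover have "V1 \<inter> V2 = {}" using bip by (simp add: bipartition_def)
    ultimately show ?thesis by (auto simp: doubleton_eq_iff)
  qed
  have alternate: "vs ! i \<in> V1 \<longleftrightarrow> (even i \<longleftrightarrow> vs ! 0 \<in> V1)" if "i < ?n" for i
    using that
  proof (induction i)
    case (Suc i)
    then show ?case using switch[of i] by auto
  qed simp
  show ?thesis using alternate[of "?n - 1"] switch[of "?n - 1"] False by auto
qed simp

lemma finite_k_cycle: "C \<in> k_cycles k G \<Longrightarrow> finite C"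
  by (auto simp: k_cycles_def closed_walk_edges_eq_image)

lemma card_k_cycle_le: "C \<in> k_cycles k G \<Longrightarrow> card C \<le> k"
  using card_image_le[of "{..<k}"] by (auto simp: k_cycles_def closed_walk_edges_eq_image)

lemma k_cycle_nonempty: "C \<in> k_cycles k G \<Longrightarrow> C \<noteq> {}"
  by (auto simp: k_cycles_def closed_walk_edges_eq_image lessThan_empty_iff)

lemma k_cycle_subset_edges: "C \<in> k_cycles k G \<Longrightarrow> C \<subseteq> edges G"
  by (auto simp: k_cycles_def)

lemma odd_k_cycle_not_subset_bipartite:
  assumes "bipartition B V1 V2" "odd k" "C \<in> k_cycles k G"
  shows "\<not> C \<subseteq> edges B"
proof -
  obtain vs where "C = closed_walk_edges vs" "length vs = k"
    using assms(3) by (auto simp: k_cycles_def)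
  then show ?thesis using even_length_bipartite_closed_walk[OF assms(1)] assms(2) by blast
qed

lemma k_cycles_delete_edges:
  "C \<in> k_cycles k (delete_edges G F) \<longleftrightarrow> C \<in> k_cycles k G \<and> C \<inter> F = {}"
  by (auto simp: k_cycles_def delete_edges_def)

definition k_cycle_edges :: "nat \<Rightarrow> 'a graph \<Rightarrow> 'a set set" where
  "k_cycle_edges k G = \<Union> (k_cycles k G)"

lemma k_cycle_edges_subset: "k_cycle_edges k G \<subseteq> edges G"
  unfolding k_cycle_edges_def by (rule Sup_least) (rule k_cycle_subset_edges)

lemma k_cycle_edges_delete_edges_subset: "k_cycle_edges k (delete_edges G F) \<subseteq> edges G - F"
  using k_cycle_edges_subset[of k "delete_edges G F"] by (simp add: delete_edges_def)

lemma k_cycle_covering_iff: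
  "k_cycle_covering k G A \<longleftrightarrow> A \<subseteq> edges G \<and> (\<forall>C\<in>k_cycles k G. C \<inter> A \<noteq> {})"
  unfolding k_cycle_covering_def using k_cycles_delete_edges[of _ k G A] by auto

lemma k_cycle_covering_edges: "k_cycle_covering k G (edges G)"
  using k_cycle_nonempty[of _ k G] k_cycle_subset_edges[of _ k G]
  by (simp add: k_cycle_covering_iff Int_absorb2)

lemma k_cycle_covering_Un_Diff:
  assumes "F \<subseteq> edges G" and cycle_free: "\<And>C. C \<in> k_cycles k G \<Longrightarrow> \<not> C \<subseteq> M"
  shows "k_cycle_covering k G (F \<union> (k_cycle_edges k (delete_edges G F) - M))"
  unfolding k_cycle_covering_iff
proof (intro conjI ballI)
  show "F \<union> (k_cycle_edges k (delete_edges G F) - M) \<subseteq> edges G"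
    using assms(1) k_cycle_edges_delete_edges_subset[of k G F] by blast
  fix C assume C: "C \<in> k_cycles k G"
  show "C \<inter> (F \<union> (k_cycle_edges k (delete_edges G F) - M)) \<noteq> {}"
  proof (cases "C \<inter> F = {}")
    case True
    then have "C \<subseteq> k_cycle_edges k (delete_edges G F)"
      using C k_cycles_delete_edges[of C k G F] by (auto simp: k_cycle_edges_def)
    then show ?thesis using cycle_free[OF C] by blast
  qed blast
qed

lemma covering_number_attained:
  assumes "graph G"
  obtains A where "k_cycle_covering k G A" "covering_number k G w = weight w A"
proof -
  let ?S = "{weight w A | A. k_cycle_covering k G A}"
  have "?S \<subseteq> weight w ` Pow (edges G)" by (auto simp: k_cycle_covering_def)
  then have "finite ?S" by (rule finite_subset) (simp add: finite_edges[OF assms])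
  moreover have "?S \<noteq> {}" using k_cycle_covering_edges by blast
  ultimately have "covering_number k G w \<in> ?S" unfolding covering_number_def by (rule Min_in)
  then show ?thesis using that by auto
qed

definition fractional_weight :: "('a set \<Rightarrow> nat) \<Rightarrow> ('a set \<Rightarrow> real) \<Rightarrow> 'a set set \<Rightarrow> real" where
  "fractional_weight w x F = (\<Sum>e\<in>F. real (w e) * x e)"

lemma lp_value_eq_fractional_weight: "lp_value G w x = fractional_weight w x (edges G)"
  by (simp add: lp_value_def fractional_weight_def)

lemma fractional_weight_Un_disjoint:
  assumes "finite A" "finite B" "A \<inter> B = {}"
  shows "fractional_weight w x (A \<union> B) = fractional_weight w x A + fractional_weight w x B"
  using assms by (simp add: fractional_weight_def sum.union_disjoint)

lemma fractional_weight_mono: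
  assumes "finite B" "A \<subseteq> B" "\<And>e. e \<in> B \<Longrightarrow> 0 \<le> x e"
  shows "fractional_weight w x A \<le> fractional_weight w x B"
  unfolding fractional_weight_def using assms by (intro sum_mono2) auto

lemma mult_weight_le_mult_fractional_weight:
  assumes "\<And>e. e \<in> F \<Longrightarrow> b \<le> c * x e"
  shows "b * real (weight w F) \<le> c * fractional_weight w x F"
proof -
  have "b * real (weight w F) = (\<Sum>e\<in>F. real (w e) * b)"
    by (simp add: weight_def sum_distrib_left mult.commute)
  also have "\<dots> \<le> (\<Sum>e\<in>F. real (w e) * (c * x e))"
    by (intro sum_mono mult_left_mono) (use assms in auto)
  also have "\<dots> = c * fractional_weight w x F"
    by (simp add: fractional_weight_def sum_distrib_left mult.left_commute)
  finally show ?thesis .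
qed

lemma lp_value_of_bool:
  assumes "graph G" "A \<subseteq> edges G"
  shows "lp_value G w (\<lambda>e. of_bool (e \<in> A)) = real (weight w A)"
  using assms finite_edges[OF assms(1)] by (simp add: lp_value_def weight_def Int_absorb1)

lemma lp_feasible_iff:
  assumes "graph G"
  shows "lp_feasible k G x \<longleftrightarrow>
    (\<forall>C\<in>k_cycles k G. 1 \<le> sum x C) \<and> (\<forall>e\<in>edges G. 0 \<le> x e \<and> x e \<le> 1)"
proof -
  have "(\<Sum>e\<in>edges G. incidence C e * x e) = sum x C" if "C \<in> k_cycles k G" for C
  proof -
    have "incidence C = (\<lambda>e. of_bool (e \<in> C))" by (auto simp: incidence_def)
    then show ?thesis
      using finite_edges[OF assms] k_cycle_subset_edges[OF that] by (simp add: Int_absorb1)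
  qed
  then show ?thesis by (simp add: lp_feasible_def)
qed

lemma k_cycle_covering_imp_lp_feasible:
  assumes "graph G" "k_cycle_covering k G A"
  shows "lp_feasible k G (\<lambda>e. of_bool (e \<in> A))"
proof -
  have "1 \<le> (\<Sum>e\<in>C. of_bool (e \<in> A) :: real)" if "C \<in> k_cycles k G" for C
  proof -
    have "C \<inter> A \<noteq> {}" using assms(2) that by (simp add: k_cycle_covering_iff)
    then have "1 \<le> card (C \<inter> A)"
      using finite_k_cycle[OF that] by (simp add: Suc_le_eq card_gt_0_iff)
    then show ?thesis using finite_k_cycle[OF that] by simp
  qed
  then show ?thesis by (simp add: lp_feasible_iff[OF assms(1)])
qed

lemma lp_optimal_le_covering_number:
  assumes "graph G" "lp_optimal k G w x"
  shows "lp_value G w x \<le> real (covering_number k G w)"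
proof -
  obtain A where A: "k_cycle_covering k G A" "covering_number k G w = weight w A"
    using covering_number_attained[OF assms(1)] .
  have "lp_value G w x \<le> lp_value G w (\<lambda>e. of_bool (e \<in> A))"
    using assms(2) k_cycle_covering_imp_lp_feasible[OF assms(1) A(1)] by (simp add: lp_optimal_def)
  also have "\<dots> = real (weight w A)"
    using A(1) lp_value_of_bool[OF assms(1)] by (simp add: k_cycle_covering_def)
  finally show ?thesis by (simp add: A(2))
qed

definition heavy_edges :: "'a graph \<Rightarrow> ('a set \<Rightarrow> real) \<Rightarrow> real \<Rightarrow> 'a set set" where
  "heavy_edges G x t = {e \<in> edges G. t \<le> x e}"

lemma residual_edge_lower_bound:
  assumes "graph G" "lp_feasible k G x" "0 \<le> t"
    and residual: "e \<in> k_cycle_edges k (delete_edges G (heavy_edges G x t))"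
  shows "1 - (real k - 1) * t \<le> x e"
proof -
  obtain C where C: "C \<in> k_cycles k G" "C \<inter> heavy_edges G x t = {}" "e \<in> C"
    using residual by (auto simp: k_cycle_edges_def k_cycles_delete_edges)
  have light: "x f \<le> t" if "f \<in> C" for f
    using that C(2) k_cycle_subset_edges[OF C(1)] linear[of "x f" t]
    by (auto simp: heavy_edges_def)
  have "1 \<le> sum x C" using assms(2) C(1) by (simp add: lp_feasible_iff[OF assms(1)])
  also have "\<dots> \<le> x e + real (card C - 1) * t"
    using finite_k_cycle[OF C(1)] C(3) light by (rule sum_le_member_plus_bound)
  also have "\<dots> \<le> x e + (real k - 1) * t"
  proof -
    have "0 < card C" using finite_k_cycle[OF C(1)] C(3) by (auto simp: card_gt_0_iff)
    then have "real (card C - 1) \<le> real k - 1" using card_k_cycle_le[OF C(1)] by linarith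
    then show ?thesis using assms(3) by (simp add: mult_right_mono)
  qed
  finally show ?thesis by simp
qed

lemma weight_Un_le_lp_value:
  assumes "graph G" "0 \<le> c" and nonneg: "\<And>e. e \<in> edges G \<Longrightarrow> 0 \<le> x e"
    and sets: "A \<subseteq> edges G" "F \<subseteq> edges G" "A \<inter> F = {}" "D \<subseteq> F"
    and weight_A: "real (weight w A) \<le> c * fractional_weight w x A"
    and weight_D: "real (weight w D) \<le> c * fractional_weight w x F"
  shows "real (weight w (A \<union> D)) \<le> c * lp_value G w x"
proof -
  have fin: "finite A" "finite F" "finite D"
    using sets finite_edges[OF assms(1)] by (meson finite_subset)+
  have "weight w (A \<union> D) = weight w A + weight w D"
    unfolding weight_def by (rule sum.union_disjoint) (use fin sets in auto)
  then have "real (weight w (A \<union> D)) \<le> c * (fractional_weight w x A + fractional_weight w x F)"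
    using weight_A weight_D by (simp add: distrib_left)
  also have "\<dots> = c * fractional_weight w x (A \<union> F)"
    using fin sets(3) by (simp add: fractional_weight_Un_disjoint)
  also have "\<dots> \<le> c * lp_value G w x"
    unfolding lp_value_eq_fractional_weight
    using sets nonneg finite_edges[OF assms(1)]
    by (intro mult_left_mono fractional_weight_mono assms(2)) auto
  finally show ?thesis .
qed

lemma weight_threshold_rounding_le:
  fixes k :: nat and G :: "'a graph" and x :: "'a set \<Rightarrow> real" and t :: real
  defines "H \<equiv> heavy_edges G x t"
  defines "R \<equiv> k_cycle_edges k (delete_edges G H)"
  assumes "graph G" and feasible: "lp_feasible k G x" and "0 \<le> t"
    and heavy_ratio: "1 \<le> c * t" and residual_ratio: "b \<le> c * (1 - (real k - 1) * t)"
    and D: "D \<subseteq> R" "real (weight w D) \<le> b * real (weight w R)"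
  shows "real (weight w (H \<union> D)) \<le> c * lp_value G w x"
proof (rule weight_Un_le_lp_value[OF \<open>graph G\<close> _ _ _ _ _ D(1)])
  show "0 \<le> c"
  proof (rule ccontr)
    assume "\<not> 0 \<le> c"
    then have "c * t \<le> 0" using \<open>0 \<le> t\<close> by (simp add: mult_nonpos_nonneg)
    then show False using heavy_ratio by simp
  qed
  show "0 \<le> x e" if "e \<in> edges G" for e
    using feasible that by (simp add: lp_feasible_def)
  show "H \<subseteq> edges G" by (auto simp: H_def heavy_edges_def)
  show "R \<subseteq> edges G" "H \<inter> R = {}"
    using k_cycle_edges_delete_edges_subset[of k G H] by (auto simp: R_def)
  have "1 \<le> c * x e" if "e \<in> H" for e
  proof -
    have "c * t \<le> c * x e"
      using that \<open>0 \<le> c\<close> by (simp add: H_def heavy_edges_def mult_left_mono)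
    then show ?thesis using heavy_ratio by linarith
  qed
  then show "real (weight w H) \<le> c * fractional_weight w x H"
    using mult_weight_le_mult_fractional_weight[of H 1 c x w] by simp
  have "b \<le> c * x e" if "e \<in> R" for e
  proof -
    have "1 - (real k - 1) * t \<le> x e"
      using residual_edge_lower_bound[OF \<open>graph G\<close> feasible \<open>0 \<le> t\<close>] that
      by (simp add: H_def R_def)
    then have "c * (1 - (real k - 1) * t) \<le> c * x e" using \<open>0 \<le> c\<close> by (rule mult_left_mono)
    then show ?thesis using residual_ratio by linarith
  qed
  then have "b * real (weight w R) \<le> c * fractional_weight w x R"
    by (rule mult_weight_le_mult_fractional_weight)
  then show "real (weight w D) \<le> c * fractional_weight w x R" using D(2) by linarith
qed

lemma weight_Diff_le:
  assumes "finite F" "M \<subseteq> F" "a * real (weight w F) \<le> real (weight w M)"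
  shows "real (weight w (F - M)) \<le> (1 - a) * real (weight w F)"
proof -
  have "weight w F = weight w (F - M) + weight w M"
    unfolding weight_def by (rule sum.subset_diff[OF assms(2,1)])
  then show ?thesis using assms(3) by (simp add: left_diff_distrib)
qed

theorem theorem1:
  fixes k :: nat and G :: "'a graph" and w :: "'a set \<Rightarrow> nat"
    and x :: "'a set \<Rightarrow> real"
    and Ek1 E' Ek2 Ek :: "'a set set"
    and G' B :: "'a graph" and V1 V2 :: "'a set"
  assumes "3 \<le> k" and "odd k" and "graph G"
    and "lp_optimal k G w x"
    and "Ek1 = {e \<in> edges G. x e \<ge> 2 / (2 * real k - 1)}"
    and "E' = {e \<in> edges G. \<exists>C\<in>k_cycles k (delete_edges G Ek1). e \<in> C}"
    and "G' = formed_by E'"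
    and "subgraph B G'" and "bipartition B V1 V2"
    and "real (weight w (edges B)) \<ge> 1 / 2 * real (weight w E')"
    and "Ek2 = E' - edges B"
    and "Ek = Ek1 \<union> Ek2"
  shows "k_cycle_covering k G Ek \<and>
    real (weight w Ek) \<le> (real k - 1 / 2) * real (covering_number k G w)"
proof
  let ?t = "2 / (2 * real k - 1)" and ?c = "real k - 1 / 2"
  have Ek1_eq: "Ek1 = heavy_edges G x ?t" using assms(5) by (simp add: heavy_edges_def)
  have E'_eq: "E' = k_cycle_edges k (delete_edges G Ek1)"
    using assms(6) k_cycle_edges_delete_edges_subset[of k G Ek1] by (auto simp: k_cycle_edges_def)
  have Ek_eq: "Ek = Ek1 \<union> (E' - edges B)" using assms(11,12) by simp
  show "k_cycle_covering k G Ek"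
    unfolding Ek_eq E'_eq using assms(5) odd_k_cycle_not_subset_bipartite[OF assms(9,2)]
    by (intro k_cycle_covering_Un_Diff) auto
  have "edges B \<subseteq> E'" using assms(7,8) by (simp add: subgraph_def formed_by_def)
  moreover have "finite E'" using assms(6) finite_edges[OF assms(3)] by simp
  ultimately have half: "real (weight w (E' - edges B)) \<le> 1 / 2 * real (weight w E')"
    using weight_Diff_le[OF _ _ assms(10)] by simp
  have ratios: "1 \<le> ?c * ?t" "1 / 2 \<le> ?c * (1 - (real k - 1) * ?t)" "0 \<le> ?t"
    using assms(1) by (auto simp: field_simps)
  have "lp_feasible k G x" using assms(4) by (simp add: lp_optimal_def)
  then have "real (weight w Ek) \<le> ?c * lp_value G w x"
    using weight_threshold_rounding_le[OF assms(3) _ ratios(3,1,2)] half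
    unfolding Ek_eq E'_eq Ek1_eq by blast
  also have "\<dots> \<le> ?c * real (covering_number k G w)"
    using assms(1) lp_optimal_le_covering_number[OF assms(3,4)] by (intro mult_left_mono) auto
  finally show "real (weight w Ek) \<le> ?c * real (covering_number k G w)" .
qed

end
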